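(* Let $s\ge0$ be an integer with $s\ne1$, let $h\in\mathbb C\setminus\{0\}$, and let $q\in\mathbb C\setminus\{0\}$ be either $1$ or not a root of unity. Let $n\ge1$ and let $\mathbf r=(r_1,\ldots,r_n)$, $\mathbf s=(s_1,\ldots,s_n)$ be sequences of nonnegative integers. Then, as formal power series in $x$, $$B^{\mathbf r,\mathbf s}_{s,h,q}[x]=\left(\sum_{j=0}^\infty h^{|\mathbf s|-j}(-1)^jq^{\binom j2(1-s)}\frac{x^j}{[j]_{q,1-s}!}\right)\left(\sum_{j=0}^\infty\Omega^{\mathbf r,\mathbf s}_{s,q}[j]\frac{x^j}{h^j[j]_{q,1-s}!}\right),$$ where $$\Omega^{\mathbf r,\mathbf s}_{s,q}[j]=\prod_{t=1}^n\bigl[\,j-(s_1+\cdots+s_{t-1})+(r_1+\cdots+r_{t-1})/(1-s)\,\bigr]^{(\underline{s_t})}_{q,1-s}.$$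
   Context: For an integer $x$, $[x]_q=\frac{q^x-1}{q-1}$ if $q\ne1$ and $[x]_1=x$. For $r\in\mathbb R$ and an integer $j\ge0$, $[r]^{(\underline j)}_{q,1-s}=[r(1-s)]_q[(r-1)(1-s)]_q\cdots[(r-j+1)(1-s)]_q$ (in the statement all the numbers $(r-i)(1-s)$ that occur are integers), and $[n]_{q,1-s}!=[n]^{(\underline n)}_{q,1-s}$. $|\cdot|$ denotes the sum of the entries of a finite sequence. The numbers $S^{\mathbf r,\mathbf s}_{s,h,q}[k]$ are the normal ordering coefficients of $H_{\mathbf r,\mathbf s}=V^{r_n}U^{s_n}\cdots V^{r_2}U^{s_2}V^{r_1}U^{s_1}$ where $UV-qVU=hV^s$: in the algebra $\mathbb C\langle U,V\rangle/(UV-qVU-hV^s)$ (in which the monomials $V^iU^j$, $i,j\ge0$, form a basis), $H_{\mathbf r,\mathbf s}=\sum_{k=s_1}^{|\mathbf s|}S^{\mathbf r,\mathbf s}_{s,h,q}[k]\,V^{|\mathbf r|-(|\mathbf s|-k)(1-s)}U^k$, the coefficient being taken as $0$ when the exponent of $V$ is negative. The generalized $q$-Bell polynomial is $B^{\mathbf r,\mathbf s}_{s,h,q}[x]=\sum_{k=s_1}^{|\mathbf s|}S^{\mathbf r,\mathbf s}_{s,h,q}[k]x^k$. *)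

theory Defs
  imports
    "HOL-Library.Poly_Mapping"
    "HOL-Computational_Algebra.Polynomial_FPS"
    Complex_Main
begin

datatype letter = LU | LV

datatype word = Word (letters: "letter list")

instantiation word :: monoid_add
begin

definition zero_word :: word where
  "0 = Word []"

definition plus_word :: "word \<Rightarrow> word \<Rightarrow> word" where
  "v + w = Word (letters v @ letters w)"

instance
  by standard (simp_all add: zero_word_def plus_word_def)

end

text \<open>
  The free algebra on \<open>U\<close> and \<open>V\<close> over the complex numbers is the monoid algebra of the free
  monoid of words in two letters.  The constructor \<open>Word\<close> wraps lists so that words can be made
  an instance of \<^class>\<open>monoid_add\<close> (concatenation written additively); the product of
  \<^typ>\<open>word \<Rightarrow>\<^sub>0 complex\<close> is then the convolution product of the monoid algebra.
\<close>

type_synonym free_algebra = "word \<Rightarrow>\<^sub>0 complex"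

definition gen_U :: free_algebra where
  "gen_U = Poly_Mapping.single (Word [LU]) 1"

definition gen_V :: free_algebra where
  "gen_V = Poly_Mapping.single (Word [LV]) 1"

definition scalar :: "complex \<Rightarrow> free_algebra" where
  "scalar c = Poly_Mapping.single 0 c"

definition two_sided_ideal :: "'a::ring_1 set \<Rightarrow> bool" where
  "two_sided_ideal I \<longleftrightarrow>
     0 \<in> I \<and> (\<forall>a\<in>I. \<forall>b\<in>I. a + b \<in> I) \<and> (\<forall>a\<in>I. \<forall>x y. x * a * y \<in> I)"

definition relation_ideal :: "nat \<Rightarrow> complex \<Rightarrow> complex \<Rightarrow> free_algebra set" where
  "relation_ideal s h q =
     two_sided_ideal hull
       {gen_U * gen_V - scalar q * gen_V * gen_U - scalar h * gen_V ^ s}"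

text \<open>Equality in the quotient algebra defined by the relation \<open>UV - qVU = hV\<^sup>s\<close>.\<close>

definition quot_eq ::
    "nat \<Rightarrow> complex \<Rightarrow> complex \<Rightarrow> free_algebra \<Rightarrow> free_algebra \<Rightarrow> bool" where
  "quot_eq s h q a b \<longleftrightarrow> a - b \<in> relation_ideal s h q"

definition normal_sum :: "(nat \<times> nat \<Rightarrow>\<^sub>0 complex) \<Rightarrow> free_algebra" where
  "normal_sum c =
     (\<Sum>(i, j)\<in>Poly_Mapping.keys c. scalar (Poly_Mapping.lookup c (i, j)) * gen_V ^ i * gen_U ^ j)"

text \<open>
  The coordinates of (the class of) \<open>a\<close> in the basis \<open>V\<^sup>i U\<^sup>j\<close> of the quotient algebra.  They exist
  and are unique, because these monomials do form a basis for all \<open>s\<close>, \<open>h\<close>, \<open>q\<close>.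
\<close>

definition normal_coeffs ::
    "nat \<Rightarrow> complex \<Rightarrow> complex \<Rightarrow> free_algebra \<Rightarrow> (nat \<times> nat \<Rightarrow>\<^sub>0 complex)" where
  "normal_coeffs s h q a = (THE c. quot_eq s h q a (normal_sum c))"

text \<open>The list is reversed since the factor with the smallest index is the rightmost one.\<close>

definition H_word :: "nat list \<Rightarrow> nat list \<Rightarrow> free_algebra" where
  "H_word rs ss = prod_list (rev (map2 (\<lambda>r s. gen_V ^ r * gen_U ^ s) rs ss))"

definition S_coeff ::
    "nat \<Rightarrow> complex \<Rightarrow> complex \<Rightarrow> nat list \<Rightarrow> nat list \<Rightarrow> nat \<Rightarrow> complex" where
  "S_coeff s h q rs ss k =
     (let e = int (sum_list rs) - (int (sum_list ss) - int k) * (1 - int s)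
      in if e < 0 then 0
         else Poly_Mapping.lookup (normal_coeffs s h q (H_word rs ss)) (nat e, k))"

definition bell_poly ::
    "nat \<Rightarrow> complex \<Rightarrow> complex \<Rightarrow> nat list \<Rightarrow> nat list \<Rightarrow> complex poly" where
  "bell_poly s h q rs ss = (\<Sum>k\<in>{hd ss..sum_list ss}. monom (S_coeff s h q rs ss k) k)"

definition q_num :: "complex \<Rightarrow> int \<Rightarrow> complex" where
  "q_num q x = (if q = 1 then of_int x else (q powi x - 1) / (q - 1))"

text \<open>
  \<open>q_falling q p r j\<close> is the product of the \<open>q\<close>-numbers of \<open>rp, (r-1)p, \<dots>, (r-j+1)p\<close>.  It is
  meant for \<open>r\<close> such that all \<open>(r-i)p\<close> are integers; the floor only converts the type.
\<close>

definition q_falling :: "complex \<Rightarrow> int \<Rightarrow> real \<Rightarrow> nat \<Rightarrow> complex" where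
  "q_falling q p r j = (\<Prod>i<j. q_num q \<lfloor>(r - real i) * of_int p\<rfloor>)"

definition q_factorial :: "complex \<Rightarrow> int \<Rightarrow> nat \<Rightarrow> complex" where
  "q_factorial q p n = q_falling q p (real n) n"

definition Omega ::
    "nat \<Rightarrow> complex \<Rightarrow> nat list \<Rightarrow> nat list \<Rightarrow> nat \<Rightarrow> complex" where
  "Omega s q rs ss j =
     (\<Prod>t<length ss. q_falling q (1 - int s)
        (real j - real (sum_list (take t ss))
           + real (sum_list (take t rs)) / of_int (1 - int s))
        (ss ! t))"

end

theory Submission
  imports Defs
begin

text \<open>
  Let \<open>U\<close> and \<open>V\<close> act on Laurent monomials by \<open>V x\<^sup>m = x\<^sup>m\<^sup>+\<^sup>1\<close> and \<open>U x\<^sup>m = h [m] x\<^sup>m\<^sup>-\<^sup>p\<close>, where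
  \<open>p = 1 - s\<close>.  This is a representation of the quotient algebra in which the monomials \<open>V\<^sup>iU\<^sup>j\<close>
  are independent.  Applying the word \<open>H\<close> and its normal form to \<open>x\<^sup>N\<^sup>p\<close> expresses \<open>\<Omega>[N]\<close> through
  the coefficients \<open>S[k]\<close>; as an identity of power series this says that the Bell polynomial times a
  \<open>q\<close>-exponential series is the generating function of \<open>\<Omega>\<close>, and the other factor in the claim is
  the inverse of that \<open>q\<close>-exponential.
\<close>

section \<open>The free algebra acting on two-sided sequences\<close>

text \<open>Identities additive in an algebra element reduce to scaled words. Zero needs no case of
  its own, being a single term with coefficient 0.\<close>

lemma poly_mapping_single_add_induct [case_names single add]:
  assumes single: "\<And>k v. P (Poly_Mapping.single k v)"
    and add: "\<And>a b. P a \<Longrightarrow> P b \<Longrightarrow> P (a + b)"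
  shows "P (a :: 'a \<Rightarrow>\<^sub>0 'b::comm_monoid_add)"
proof (induction a rule: update_induct)
  case const
  show ?case using single[of undefined 0] by simp
next
  case (update f a b)
  have "Poly_Mapping.update a b f = f + Poly_Mapping.single a b"
    using update(1)
    by (intro poly_mapping_eqI) (auto simp: lookup_update lookup_add lookup_single in_keys_iff)
  then show ?case using add[OF update(3) single] by simp
qed

text \<open>
  The variable \<open>V\<close> shifts \<open>x\<^sup>m\<close> to \<open>x\<^sup>m\<^sup>+\<^sup>1\<close>, and \<open>U\<close> acts as \<open>h x\<^sup>s\<close> times the \<open>q\<close>-derivative.  A
  formal Laurent series is represented by its coefficient function, and no finiteness
  condition is needed for these two operators to make sense.
\<close>

fun letter_op :: "nat \<Rightarrow> complex \<Rightarrow> complex \<Rightarrow> letter \<Rightarrow> (int \<Rightarrow> complex) \<Rightarrow> int \<Rightarrow> complex" where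
  "letter_op s h q LV f n = f (n - 1)"
| "letter_op s h q LU f n = h * q_num q (n + (1 - int s)) * f (n + (1 - int s))"

text \<open>\<open>foldr\<close> lets the rightmost letter act first, so concatenation of words
  becomes composition of operators.\<close>

definition word_op :: "nat \<Rightarrow> complex \<Rightarrow> complex \<Rightarrow> word \<Rightarrow> (int \<Rightarrow> complex) \<Rightarrow> int \<Rightarrow> complex" where
  "word_op s h q w = foldr (letter_op s h q) (letters w)"

definition act :: "nat \<Rightarrow> complex \<Rightarrow> complex \<Rightarrow> free_algebra \<Rightarrow> (int \<Rightarrow> complex) \<Rightarrow> int \<Rightarrow> complex" where
  "act s h q a f n =
     (\<Sum>w\<in>Poly_Mapping.keys a. Poly_Mapping.lookup a w * word_op s h q w f n)"

lemma letter_op_add: "letter_op s h q l (\<lambda>n. f n + g n) = (\<lambda>n. letter_op s h q l f n + letter_op s h q l g n)"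
  by (cases l) (auto simp: algebra_simps)

lemma letter_op_scale: "letter_op s h q l (\<lambda>n. c * f n) = (\<lambda>n. c * letter_op s h q l f n)"
  by (cases l) (auto simp: algebra_simps)

lemma word_op_add: "word_op s h q w (\<lambda>n. f n + g n) = (\<lambda>n. word_op s h q w f n + word_op s h q w g n)"
proof -
  have "foldr (letter_op s h q) ls (\<lambda>n. f n + g n) =
      (\<lambda>n. foldr (letter_op s h q) ls f n + foldr (letter_op s h q) ls g n)" for ls
    by (induction ls) (auto simp: letter_op_add)
  then show ?thesis by (simp add: word_op_def)
qed

lemma word_op_scale: "word_op s h q w (\<lambda>n. c * f n) = (\<lambda>n. c * word_op s h q w f n)"
proof -
  have "foldr (letter_op s h q) ls (\<lambda>n. c * f n) = (\<lambda>n. c * foldr (letter_op s h q) ls f n)" for ls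
    by (induction ls) (auto simp: letter_op_scale)
  then show ?thesis by (simp add: word_op_def)
qed

lemma word_op_plus: "word_op s h q (v + w) f = word_op s h q v (word_op s h q w f)"
  by (simp add: word_op_def plus_word_def)

lemma act_single: "act s h q (Poly_Mapping.single w c) f = (\<lambda>n. c * word_op s h q w f n)"
  by (rule ext) (simp add: act_def)

lemma act_add: "act s h q (a + b) f = (\<lambda>n. act s h q a f n + act s h q b f n)"
proof (rule ext)
  show "act s h q (a + b) f n = act s h q a f n + act s h q b f n" for n
    unfolding act_def
    by (rule setsum_keys_plus_distrib[where f = "\<lambda>w c. c * word_op s h q w f n"])
       (simp_all add: distrib_right)
qed

lemma act_0: "act s h q 0 f = (\<lambda>n. 0)"
  by (rule ext) (simp add: act_def)

lemma act_diff: "act s h q (a - b) f = (\<lambda>n. act s h q a f n - act s h q b f n)"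
  using act_add[of s h q "a - b" b f] by (simp add: fun_eq_iff)

lemma act_sum: "act s h q (\<Sum>i\<in>I. a i) f = (\<lambda>n. \<Sum>i\<in>I. act s h q (a i) f n)"
  by (induction I rule: infinite_finite_induct) (simp_all add: act_0 act_add)

text \<open>Both sides are additive in \<open>a\<close> and in \<open>b\<close>, so only scaled
  words matter; there \<open>word_op_plus\<close> and linearity of \<open>word_op\<close>
  suffice.\<close>

lemma act_mult: "act s h q (a * b) f = act s h q a (act s h q b f)"
proof (induction a rule: poly_mapping_single_add_induct)
  case (single v c)
  show ?case
  proof (induction b rule: poly_mapping_single_add_induct)
    case (single w d)
    show ?case
      by (simp add: mult_single act_single word_op_plus word_op_scale mult.assoc)
  next
    case (add b1 b2)
    then show ?case
      by (simp add: distrib_left act_add)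
         (simp add: act_single word_op_add distrib_left)
  qed
next
  case (add a1 a2)
  then show ?case by (simp add: distrib_right act_add)
qed

lemma act_scalar: "act s h q (scalar c) f = (\<lambda>n. c * f n)"
  by (simp add: scalar_def act_single word_op_def zero_word_def)

lemma act_scale: "act s h q a (\<lambda>n. c * f n) = (\<lambda>n. c * act s h q a f n)"
  by (rule ext) (simp add: act_def word_op_scale sum_distrib_left mult_ac)

lemma act_one: "act s h q 1 f = f"
  by (simp add: act_single word_op_def zero_word_def flip: single_one)

lemma act_gen_V: "act s h q gen_V f = (\<lambda>n. f (n - 1))"
  by (rule ext) (simp add: gen_V_def act_single word_op_def)

lemma act_gen_U:
  "act s h q gen_U f = (\<lambda>n. h * q_num q (n + (1 - int s)) * f (n + (1 - int s)))"
  by (rule ext) (simp add: gen_U_def act_single word_op_def)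

lemma act_gen_V_power: "act s h q (gen_V ^ i) f = (\<lambda>n. f (n - int i))"
  by (induction i) (auto simp: act_one act_mult act_gen_V algebra_simps)

section \<open>Arithmetic of q-numbers\<close>

lemma q_num_0 [simp]: "q_num q 0 = 0"
  by (simp add: q_num_def)

text \<open>After multiplication by \<open>q - 1\<close> this is q^(x+y) - 1 = (q^x - 1) + q^x (q^y
  - 1). It drives the defining relation, the commutation rule and the telescoping sum.\<close>

lemma q_num_add:
  assumes "q \<noteq> 0"
  shows "q_num q (x + y) = q_num q x + q powi x * q_num q y"
proof (cases "q = 1")
  case False
  have eq: "q_num q z * (q - 1) = q powi z - 1" for z
    using False by (simp add: q_num_def)
  have "q_num q (x + y) * (q - 1) = q powi x - 1 + q powi x * (q powi y - 1)"
    unfolding eq using assms by (simp add: power_int_add algebra_simps)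
  also have "\<dots> = (q_num q x + q powi x * q_num q y) * (q - 1)"
    by (simp add: distrib_right eq mult.assoc)
  finally have "q_num q (x + y) * (q - 1) = (q_num q x + q powi x * q_num q y) * (q - 1)" .
  then show ?thesis using False by simp
qed (simp add: q_num_def)

lemma q_num_1 [simp]: "q_num q 1 = 1"
  by (simp add: q_num_def)

lemma q_num_neq_0:
  assumes "q \<noteq> 0" "q = 1 \<or> (\<forall>m::nat. m > 0 \<longrightarrow> q ^ m \<noteq> 1)" "x \<noteq> 0"
  shows "q_num q x \<noteq> 0"
proof (cases "q = 1")
  case False
  have "q ^ nat \<bar>x\<bar> \<noteq> 1" using assms False by simp
  then have "q powi x \<noteq> 1"
    by (auto simp: power_int_def abs_if power_inverse split: if_splits)
  then show ?thesis using False by (simp add: q_num_def)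
qed (use assms in \<open>simp add: q_num_def\<close>)

section \<open>The action descends to the quotient algebra\<close>

lemma act_relation:
  assumes "q \<noteq> 0"
  shows "act s h q (gen_U * gen_V - scalar q * gen_V * gen_U - scalar h * gen_V ^ s) f = (\<lambda>n. 0)"
proof (rule ext)
  fix n
  have "q_num q (1 + (n - int s)) = 1 + q * q_num q (n - int s)"
    using q_num_add[OF assms, of 1 "n - int s"] by simp
  then show "act s h q (gen_U * gen_V - scalar q * gen_V * gen_U - scalar h * gen_V ^ s) f n = 0"
    by (simp add: act_diff act_mult act_scalar act_gen_U act_gen_V act_gen_V_power)
       (simp add: algebra_simps)
qed

text \<open>The elements acting as zero form a two-sided ideal containing the relation, hence
  containing the ideal it generates.\<close>

lemma act_relation_ideal:
  assumes "q \<noteq> 0" "a \<in> relation_ideal s h q"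
  shows "act s h q a f = (\<lambda>n. 0)"
proof -
  let ?K = "{a. \<forall>f. act s h q a f = (\<lambda>n. 0)}"
  have "act s h q a (\<lambda>n. 0) = (\<lambda>n. 0)" for a
    using act_scale[of s h q a 0] by simp
  then have "two_sided_ideal ?K"
    by (simp add: two_sided_ideal_def act_0 act_add act_mult)
  then have "relation_ideal s h q \<subseteq> ?K"
    unfolding relation_ideal_def by (intro hull_minimal) (auto simp: act_relation[OF assms(1)])
  then show ?thesis using assms(2) by auto
qed

lemma act_quot_eq:
  assumes "q \<noteq> 0" "quot_eq s h q a b"
  shows "act s h q a f = act s h q b f"
  using act_relation_ideal[OF assms(1), of "a - b" s h f] assms(2)
  by (simp add: quot_eq_def act_diff fun_eq_iff)

text \<open>The coefficient function of the Laurent monomial x^m.\<close>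

definition delta :: "int \<Rightarrow> int \<Rightarrow> complex" where
  "delta m n = (if n = m then 1 else 0)"

lemma act_gen_V_power_delta: "act s h q (gen_V ^ i) (delta m) = delta (m + int i)"
  by (auto simp: act_gen_V_power delta_def)

lemma act_gen_U_power_delta:
  "act s h q (gen_U ^ j) (delta m) =
     (\<lambda>n. h ^ j * (\<Prod>t<j. q_num q (m - int t * (1 - int s))) * delta (m - int j * (1 - int s)) n)"
proof (induction j)
  case 0
  then show ?case by (simp add: act_one)
next
  case (Suc j)
  have U: "act s h q gen_U (delta m') = (\<lambda>n. h * q_num q m' * delta (m' - (1 - int s)) n)" for m'
    by (auto simp: act_gen_U delta_def)
  show ?case
    by (simp add: act_mult Suc act_scale U) (simp add: algebra_simps)
qed

lemma act_gen_V_gen_U_power_delta: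
  "act s h q (gen_V ^ i * gen_U ^ j) (delta m) =
     (\<lambda>n. h ^ j * (\<Prod>t<j. q_num q (m - int t * (1 - int s)))
          * delta (m - int j * (1 - int s) + int i) n)"
  by (simp add: act_mult act_gen_U_power_delta act_scale act_gen_V_power_delta)

section \<open>Existence and uniqueness of normal forms\<close>

lemma normal_sum_eq:
  "normal_sum c = (\<Sum>k\<in>Poly_Mapping.keys c.
     scalar (Poly_Mapping.lookup c k) * gen_V ^ fst k * gen_U ^ snd k)"
  by (simp add: normal_sum_def case_prod_unfold)

lemma normal_sum_add: "normal_sum (c + d) = normal_sum c + normal_sum d"
  unfolding normal_sum_eq
  by (rule setsum_keys_plus_distrib[where f = "\<lambda>k x. scalar x * gen_V ^ fst k * gen_U ^ snd k"])
     (simp_all add: scalar_def single_add distrib_right)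

lemma normal_sum_diff: "normal_sum (c - d) = normal_sum c - normal_sum d"
  using normal_sum_add[of "c - d" d] by (simp add: algebra_simps)

lemma normal_sum_0: "normal_sum 0 = 0"
  by (simp add: normal_sum_eq)

lemma normal_sum_single: "normal_sum (Poly_Mapping.single (i, j) x) = scalar x * gen_V ^ i * gen_U ^ j"
  by (simp add: normal_sum_eq scalar_def)

lemma act_normal_sum_delta:
  "act s h q (normal_sum c) (delta m) n =
     (\<Sum>(i, j)\<in>Poly_Mapping.keys c. Poly_Mapping.lookup c (i, j) *
        (h ^ j * (\<Prod>t<j. q_num q (m - int t * (1 - int s)))
          * delta (m - int j * (1 - int s) + int i) n))"
  by (simp add: normal_sum_eq act_sum mult.assoc case_prod_unfold)
     (simp add: act_mult[of s h q "scalar x" for x] act_scalar act_gen_V_gen_U_power_delta mult.assoc)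

text \<open>Let the difference \<open>e\<close> act on x^(jp) with p = 1 - s, by strong induction on
  \<open>j\<close>. Terms with fewer than \<open>j\<close> letters U vanish by induction; those with
  more contain the factor [0]; those with exactly \<open>j\<close> are separated by their V
  exponent, which is the exponent of the resulting monomial.\<close>

lemma normal_sum_unique:
  assumes "s \<noteq> 1" "h \<noteq> 0" "q \<noteq> 0" "q = 1 \<or> (\<forall>m::nat. m > 0 \<longrightarrow> q ^ m \<noteq> 1)"
    and "quot_eq s h q (normal_sum c) (normal_sum d)"
  shows "c = d"
proof -
  define e where "e = c - d"
  have act0: "act s h q (normal_sum e) f = (\<lambda>n. 0)" for f
    using act_quot_eq[OF assms(3,5)] by (simp add: e_def normal_sum_diff act_diff)
  have "Poly_Mapping.lookup e (i, j) = 0" for i j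
  proof (induction j arbitrary: i rule: less_induct)
    case (less j)
    let ?m = "int j * (1 - int s)"
    let ?F = "\<lambda>(i', j'). Poly_Mapping.lookup e (i', j') *
        (h ^ j' * (\<Prod>t<j'. q_num q (?m - int t * (1 - int s)))
          * delta (?m - int j' * (1 - int s) + int i') (int i))"
    show ?case
    proof (rule ccontr)
      assume nz: "Poly_Mapping.lookup e (i, j) \<noteq> 0"
      have "?F k = 0" if k: "k \<in> Poly_Mapping.keys e - {(i, j)}" for k
      proof (cases k)
        case (Pair i' j')
        consider "j' < j" | "j' > j" | "j' = j" "i' \<noteq> i" using k Pair by (cases j' j rule: linorder_cases) auto
        then show ?thesis
        proof cases
          case 1
          then show ?thesis using less Pair by simp
        next
          case 2
          then have "(\<Prod>t<j'. q_num q (?m - int t * (1 - int s))) = 0"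
            by (intro prod_zero bexI[of _ j]) auto
          then show ?thesis using Pair by simp
        next
          case 3
          then show ?thesis using Pair by (simp add: delta_def)
        qed
      qed
      then have "(\<Sum>k\<in>Poly_Mapping.keys e. ?F k) = ?F (i, j)"
        using nz by (subst sum.remove[of _ "(i, j)"]) (auto simp: in_keys_iff intro!: sum.neutral)
      moreover have "(\<Sum>k\<in>Poly_Mapping.keys e. ?F k) = 0"
        using act0[of "delta ?m"] act_normal_sum_delta[of s h q e ?m "int i"] by simp
      \<comment> \<open>The argument is (j - t)(1 - s), which is nonzero, so the one surviving term
        has a nonzero multiplier.\<close>
      moreover have "q_num q (?m - int t * (1 - int s)) \<noteq> 0" if "t < j" for t
        using that assms(1) by (intro q_num_neq_0[OF assms(3,4)]) auto
      ultimately show False using nz assms(2) by (auto simp: delta_def)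
    qed
  qed
  then have "e = 0" by (intro poly_mapping_eqI) auto
  then show ?thesis by (simp add: e_def)
qed

section \<open>Congruence modulo the relation ideal\<close>

lemma two_sided_ideal_relation_ideal: "two_sided_ideal (relation_ideal s h q)"
  unfolding relation_ideal_def
  by (rule hull_in) (fastforce simp: two_sided_ideal_def)

lemma quot_eq_refl: "quot_eq s h q a a"
  using two_sided_ideal_relation_ideal[of s h q] by (simp add: quot_eq_def two_sided_ideal_def)

lemma quot_eq_add:
  assumes "quot_eq s h q a b" "quot_eq s h q c d"
  shows "quot_eq s h q (a + c) (b + d)"
proof -
  have "(a - b) + (c - d) \<in> relation_ideal s h q"
    using two_sided_ideal_relation_ideal[of s h q] assms by (simp add: quot_eq_def two_sided_ideal_def)
  then show ?thesis by (simp add: quot_eq_def algebra_simps)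
qed

lemma quot_eq_mult_both:
  assumes "quot_eq s h q a b"
  shows "quot_eq s h q (x * a * y) (x * b * y)"
proof -
  have "x * (a - b) * y \<in> relation_ideal s h q"
    using two_sided_ideal_relation_ideal[of s h q] assms by (simp add: quot_eq_def two_sided_ideal_def)
  then show ?thesis by (simp add: quot_eq_def algebra_simps)
qed

lemma quot_eq_mult_left: "quot_eq s h q a b \<Longrightarrow> quot_eq s h q (x * a) (x * b)"
  using quot_eq_mult_both[of s h q a b x 1] by simp

lemma quot_eq_mult_right: "quot_eq s h q a b \<Longrightarrow> quot_eq s h q (a * y) (b * y)"
  using quot_eq_mult_both[of s h q a b 1 y] by simp

lemma quot_eq_sym:
  assumes "quot_eq s h q a b"
  shows "quot_eq s h q b a"
  \<comment> \<open>Adding \<open>a + b\<close> to both sides of the congruence between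
    \<open>-a\<close> and \<open>-b\<close> swaps the roles of \<open>a\<close> and
    \<open>b\<close>.\<close>
  using quot_eq_add[OF quot_eq_mult_left[OF assms, of "-1"] quot_eq_refl[of s h q "a + b"]]
  by (simp add: algebra_simps)

lemma quot_eq_trans [trans]:
  assumes "quot_eq s h q a b" "quot_eq s h q b c"
  shows "quot_eq s h q a c"
  using quot_eq_add[OF assms] by (simp add: quot_eq_def)

lemma scalar_commute: "scalar c * a = a * scalar c"
proof (induction a rule: poly_mapping_single_add_induct)
  case (single k v)
  then show ?case by (simp add: scalar_def mult_single mult.commute)
qed (simp add: algebra_simps)

lemma scalar_add: "scalar (c + d) = scalar c + scalar d"
  by (simp add: scalar_def single_add)

lemma scalar_mult: "scalar (c * d) = scalar c * scalar d"
  by (simp add: scalar_def mult_single)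

section \<open>Existence of normal forms with control of the exponents\<close>

lemma quot_eq_relation: "quot_eq s h q (gen_U * gen_V) (scalar q * gen_V * gen_U + scalar h * gen_V ^ s)"
  unfolding quot_eq_def relation_ideal_def
  by (rule hull_inc) (simp add: algebra_simps)

text \<open>Each further V contributes one more \<open>h * gen_V ^ s\<close> term, weighted by q^i,
  and [i+1] = [i] + q^i collects the weights.\<close>

lemma quot_eq_gen_U_gen_V_power:
  assumes "q \<noteq> 0"
  shows "quot_eq s h q (gen_U * gen_V ^ i)
           (scalar (q ^ i) * gen_V ^ i * gen_U
            + scalar (h * q_num q (int i)) * gen_V ^ (i + s - 1))"
proof (induction i)
  case 0
  have "scalar 1 = 1" "scalar 0 = 0" by (simp_all add: scalar_def)
  then show ?case using quot_eq_refl[of s h q gen_U] by simp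
next
  case (Suc i)
  \<comment> \<open>The natural subtraction truncates only for i = s = 0, and then the coefficient
    is zero because [0] = 0.\<close>
  have pow: "scalar (h * q_num q (int i)) * gen_V ^ (i + s - 1) * gen_V =
             scalar (h * q_num q (int i)) * gen_V ^ (i + s)"
  proof (cases "i + s")
    case 0
    then show ?thesis by (simp add: scalar_def)
  next
    case (Suc m)
    then show ?thesis by (simp only: mult.assoc power_Suc2 diff_Suc_1)
  qed
  have "gen_U * gen_V ^ Suc i = gen_U * gen_V ^ i * gen_V"
    by (simp add: mult.assoc power_Suc2 del: power_Suc)
  also have "quot_eq s h q \<dots>
      ((scalar (q ^ i) * gen_V ^ i * gen_U
        + scalar (h * q_num q (int i)) * gen_V ^ (i + s - 1)) * gen_V)"
    by (rule quot_eq_mult_right[OF Suc])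
  also have "\<dots> = scalar (q ^ i) * gen_V ^ i * (gen_U * gen_V)
      + scalar (h * q_num q (int i)) * gen_V ^ (i + s)"
    by (simp only: distrib_right pow) (simp only: mult.assoc)
  also have "quot_eq s h q \<dots> (scalar (q ^ i) * gen_V ^ i * (scalar q * gen_V * gen_U + scalar h * gen_V ^ s)
      + scalar (h * q_num q (int i)) * gen_V ^ (i + s))"
    by (intro quot_eq_add quot_eq_mult_left quot_eq_relation quot_eq_refl)
  also have "\<dots> = scalar (q ^ i) * (gen_V ^ i * scalar q) * gen_V * gen_U
       + scalar (q ^ i) * (gen_V ^ i * scalar h) * gen_V ^ s
      + scalar (h * q_num q (int i)) * gen_V ^ (i + s)"
    by (simp only: distrib_left mult.assoc)
  also have "\<dots> = scalar (q ^ i * q) * (gen_V ^ i * gen_V) * gen_U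
       + scalar (q ^ i * h + h * q_num q (int i)) * gen_V ^ (i + s)"
    by (simp only: flip: scalar_commute) (simp only: scalar_mult scalar_add distrib_right mult.assoc power_add add.assoc)
  also have "q ^ i * h + h * q_num q (int i) = h * q_num q (int (Suc i))"
    using q_num_add[OF assms, of "int i" 1] by (simp add: algebra_simps)
  finally show ?case
    by (simp only: power_Suc2 add_Suc diff_Suc_1)
qed

text \<open>The support is recorded along with existence, since \<open>S_coeff\<close> reads off
  just one V exponent for each \<open>k\<close> and the Bell polynomial only sums over a bounded
  range of \<open>k\<close>.\<close>

definition normal_form_in ::
    "nat \<Rightarrow> complex \<Rightarrow> complex \<Rightarrow> (nat \<times> nat) set \<Rightarrow> free_algebra \<Rightarrow> bool" where
  "normal_form_in s h q X a \<longleftrightarrow>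
     (\<exists>c. Poly_Mapping.keys c \<subseteq> X \<and> quot_eq s h q a (normal_sum c))"

lemma normal_form_in_add:
  assumes "normal_form_in s h q X a" "normal_form_in s h q X b"
  shows "normal_form_in s h q X (a + b)"
proof -
  obtain c d where "Poly_Mapping.keys c \<subseteq> X" "quot_eq s h q a (normal_sum c)"
    "Poly_Mapping.keys d \<subseteq> X" "quot_eq s h q b (normal_sum d)"
    using assms by (auto simp: normal_form_in_def)
  then show ?thesis
    unfolding normal_form_in_def using keys_add[of c d]
    by (intro exI[of _ "c + d"]) (auto simp: normal_sum_add intro: quot_eq_add)
qed

lemma normal_form_in_0: "normal_form_in s h q X 0"
  unfolding normal_form_in_def
  by (intro exI[of _ 0]) (simp add: normal_sum_0 quot_eq_refl)

lemma normal_form_in_sum: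
  assumes "\<And>i. i \<in> I \<Longrightarrow> normal_form_in s h q X (a i)"
  shows "normal_form_in s h q X (\<Sum>i\<in>I. a i)"
  using assms
  by (induction I rule: infinite_finite_induct) (auto intro: normal_form_in_0 normal_form_in_add)

text \<open>Membership is demanded only for nonzero \<open>x\<close>, because the term with
  coefficient [i] may leave the set of exponents when \<open>i = 0\<close>.\<close>

lemma normal_form_in_monom:
  assumes "x \<noteq> 0 \<Longrightarrow> (i, j) \<in> X"
  shows "normal_form_in s h q X (scalar x * gen_V ^ i * gen_U ^ j)"
  unfolding normal_form_in_def using assms
  by (intro exI[of _ "Poly_Mapping.single (i, j) x"])
     (auto simp: normal_sum_single quot_eq_refl)

lemma normal_form_in_quot_eq:
  assumes "quot_eq s h q a b" "normal_form_in s h q X b"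
  shows "normal_form_in s h q X a"
  using assms quot_eq_trans unfolding normal_form_in_def by blast

lemma normal_form_in_mult_left:
  assumes "normal_form_in s h q X a"
    and "\<And>i j x. (i, j) \<in> X \<Longrightarrow> normal_form_in s h q Y (b * (scalar x * gen_V ^ i * gen_U ^ j))"
  shows "normal_form_in s h q Y (b * a)"
proof -
  obtain c where c: "Poly_Mapping.keys c \<subseteq> X" "quot_eq s h q a (normal_sum c)"
    using assms(1) by (auto simp: normal_form_in_def)
  have "normal_form_in s h q Y (b * normal_sum c)"
    unfolding normal_sum_eq sum_distrib_left
    using c(1) assms(2) by (intro normal_form_in_sum) auto
  then show ?thesis using quot_eq_mult_left[OF c(2)] normal_form_in_quot_eq by blast
qed

text \<open>
  The exponents that occur in a homogeneous element of degree \<open>E\<close>, where \<open>V\<close> has degree \<open>1\<close> and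
  \<open>U\<close> has degree \<open>s - 1\<close>.
\<close>

definition homogeneous_exponents :: "nat \<Rightarrow> int \<Rightarrow> nat \<Rightarrow> nat \<Rightarrow> (nat \<times> nat) set" where
  "homogeneous_exponents s E lo hi =
     {(i, k). int i = E + int k * (1 - int s) \<and> lo \<le> k \<and> k \<le> hi}"

lemma normal_form_in_gen_V_mult:
  assumes "normal_form_in s h q (homogeneous_exponents s E lo hi) a"
  shows "normal_form_in s h q (homogeneous_exponents s (E + 1) lo hi) (gen_V * a)"
proof (rule normal_form_in_mult_left[OF assms])
  fix i j x
  assume "(i, j) \<in> homogeneous_exponents s E lo hi"
  then have "normal_form_in s h q (homogeneous_exponents s (E + 1) lo hi)
      (scalar x * gen_V ^ Suc i * gen_U ^ j)"
    by (intro normal_form_in_monom) (auto simp: homogeneous_exponents_def)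
  moreover have "gen_V * (scalar x * gen_V ^ i * gen_U ^ j) = scalar x * gen_V ^ Suc i * gen_U ^ j"
    by (simp only: scalar_commute[of x] mult.assoc power_Suc)
  ultimately show "normal_form_in s h q (homogeneous_exponents s (E + 1) lo hi)
      (gen_V * (scalar x * gen_V ^ i * gen_U ^ j))" by simp
qed

text \<open>Moving U past V^i either keeps the U, raising its exponent by one, or absorbs it into
  V^(i+s-1). Hence only the upper bound grows.\<close>

lemma normal_form_in_gen_U_mult:
  assumes "q \<noteq> 0" "normal_form_in s h q (homogeneous_exponents s E lo hi) a"
  shows "normal_form_in s h q (homogeneous_exponents s (E - (1 - int s)) lo (Suc hi)) (gen_U * a)"
proof (rule normal_form_in_mult_left[OF assms(2)])
  fix i j x
  let ?X = "homogeneous_exponents s (E - (1 - int s)) lo (Suc hi)"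
  assume ij: "(i, j) \<in> homogeneous_exponents s E lo hi"
  have nf: "normal_form_in s h q ?X (scalar (x * q ^ i) * gen_V ^ i * gen_U ^ Suc j)"
    "normal_form_in s h q ?X (scalar (x * (h * q_num q (int i))) * gen_V ^ (i + s - 1) * gen_U ^ j)"
  proof -
    show "normal_form_in s h q ?X (scalar (x * q ^ i) * gen_V ^ i * gen_U ^ Suc j)"
      using ij by (intro normal_form_in_monom) (auto simp: homogeneous_exponents_def algebra_simps)
    \<comment> \<open>With \<open>i\<close> positive, \<open>i + s - 1\<close> is an untruncated
      difference, so the degree equation holds over the integers.\<close>
    have "i \<noteq> 0" if "x * (h * q_num q (int i)) \<noteq> 0" using that by (cases i) auto
    then show "normal_form_in s h q ?X
        (scalar (x * (h * q_num q (int i))) * gen_V ^ (i + s - 1) * gen_U ^ j)"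
      using ij by (intro normal_form_in_monom) (force simp: homogeneous_exponents_def algebra_simps)
  qed
  have "gen_U * (scalar x * gen_V ^ i * gen_U ^ j) = scalar x * (gen_U * gen_V ^ i) * gen_U ^ j"
    by (simp add: scalar_commute flip: mult.assoc) (simp add: scalar_commute mult.assoc)
  also have "quot_eq s h q \<dots> (scalar x * (scalar (q ^ i) * gen_V ^ i * gen_U
            + scalar (h * q_num q (int i)) * gen_V ^ (i + s - 1)) * gen_U ^ j)"
    by (rule quot_eq_mult_both[OF quot_eq_gen_U_gen_V_power[OF assms(1)]])
  also have "\<dots> = scalar (x * q ^ i) * gen_V ^ i * gen_U ^ Suc j
      + scalar (x * (h * q_num q (int i))) * gen_V ^ (i + s - 1) * gen_U ^ j"
    by (simp only: scalar_mult distrib_left distrib_right mult.assoc power_Suc)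
  finally show "normal_form_in s h q ?X (gen_U * (scalar x * gen_V ^ i * gen_U ^ j))"
    using normal_form_in_add[OF nf] normal_form_in_quot_eq by blast
qed

lemma normal_form_in_gen_V_power_mult:
  assumes "normal_form_in s h q (homogeneous_exponents s E lo hi) a"
  shows "normal_form_in s h q (homogeneous_exponents s (E + int r) lo hi) (gen_V ^ r * a)"
proof (induction r)
  case (Suc r)
  then show ?case using normal_form_in_gen_V_mult[OF Suc] by (simp add: mult.assoc add_ac)
qed (use assms in simp)

lemma normal_form_in_gen_U_power_mult:
  assumes "q \<noteq> 0" "normal_form_in s h q (homogeneous_exponents s E lo hi) a"
  shows "normal_form_in s h q (homogeneous_exponents s (E - int r * (1 - int s)) lo (hi + r))
           (gen_U ^ r * a)"
proof (induction r)
  case (Suc r)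
  have eq: "E - int r * (1 - int s) - (1 - int s) = E - int (Suc r) * (1 - int s)"
    by (simp add: algebra_simps)
  show ?case
    using normal_form_in_gen_U_mult[OF assms(1) Suc] unfolding eq
    by (simp add: mult.assoc del: of_nat_Suc)
qed (use assms in simp)

lemma H_word_snoc:
  assumes "length rs = length ss"
  shows "H_word (rs @ [r]) (ss @ [t]) = gen_V ^ r * (gen_U ^ t * H_word rs ss)"
  using assms by (simp add: H_word_def mult.assoc)

lemma H_word_Cons: "H_word (r # rs) (t # ss) = H_word rs ss * (gen_V ^ r * gen_U ^ t)"
  by (simp add: H_word_def)

text \<open>The extra right factor \<open>a\<close> leaves room for the rightmost block, which is
  already normally ordered and supplies the lower bound on the exponent of U.\<close>

lemma normal_form_in_H_word_mult:
  assumes "q \<noteq> 0" "length rs = length ss" "normal_form_in s h q (homogeneous_exponents s E lo hi) a"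
  shows "normal_form_in s h q
     (homogeneous_exponents s (E + int (sum_list rs) - int (sum_list ss) * (1 - int s)) lo
        (hi + sum_list ss)) (H_word rs ss * a)"
  using assms(2)
proof (induction ss arbitrary: rs rule: rev_induct)
  case Nil
  then show ?case using assms(3) by (simp add: H_word_def)
next
  case (snoc t ss)
  then obtain rs' r where rs: "rs = rs' @ [r]" "length rs' = length ss"
    by (cases rs rule: rev_cases) auto
  show ?case
    using normal_form_in_gen_V_power_mult[OF
        normal_form_in_gen_U_power_mult[OF assms(1) snoc.IH[OF rs(2)]], of t r]
    unfolding rs H_word_snoc[OF rs(2)]
    by (simp add: algebra_simps)
qed

lemma normal_form_in_H_word:
  assumes "q \<noteq> 0" "length rs = length ss" "ss \<noteq> []"
  shows "normal_form_in s h q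
     (homogeneous_exponents s (int (sum_list rs) - int (sum_list ss) * (1 - int s)) (hd ss)
        (sum_list ss)) (H_word rs ss)"
proof -
  obtain r rs' t ss' where eq: "rs = r # rs'" "ss = t # ss'"
    using assms(2,3) by (cases rs; cases ss) auto
  have "normal_form_in s h q (homogeneous_exponents s (int r - int t * (1 - int s)) t t)
      (scalar 1 * gen_V ^ r * gen_U ^ t)"
    by (rule normal_form_in_monom) (simp add: homogeneous_exponents_def)
  moreover have "scalar 1 = 1" by (simp add: scalar_def)
  ultimately show ?thesis
    using normal_form_in_H_word_mult[OF assms(1), of rs' ss' s h "int r - int t * (1 - int s)" t t "gen_V ^ r * gen_U ^ t"] assms(2)
    by (simp add: eq H_word_Cons algebra_simps)
qed

text \<open>Existence provides coordinates with the right support, and uniqueness identifies them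
  with the ones chosen by \<open>THE\<close>.\<close>

lemma normal_coeffs_H_word:
  assumes "s \<noteq> 1" "h \<noteq> 0" "q \<noteq> 0" "q = 1 \<or> (\<forall>m::nat. m > 0 \<longrightarrow> q ^ m \<noteq> 1)"
    and "length rs = length ss" "ss \<noteq> []"
  defines "c \<equiv> normal_coeffs s h q (H_word rs ss)"
  shows "quot_eq s h q (H_word rs ss) (normal_sum c)"
    and "Poly_Mapping.keys c \<subseteq>
           homogeneous_exponents s (int (sum_list rs) - int (sum_list ss) * (1 - int s)) (hd ss)
             (sum_list ss)"
proof -
  obtain d where d: "quot_eq s h q (H_word rs ss) (normal_sum d)"
    "Poly_Mapping.keys d \<subseteq>
       homogeneous_exponents s (int (sum_list rs) - int (sum_list ss) * (1 - int s)) (hd ss)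
         (sum_list ss)"
    using normal_form_in_H_word[OF assms(3,5,6)] unfolding normal_form_in_def by blast
  have "c = d"
    unfolding c_def normal_coeffs_def
    using d(1) normal_sum_unique[OF assms(1-4)] quot_eq_trans quot_eq_sym
    by (intro the_equality) blast+
  then show "quot_eq s h q (H_word rs ss) (normal_sum c)"
    "Poly_Mapping.keys c \<subseteq>
       homogeneous_exponents s (int (sum_list rs) - int (sum_list ss) * (1 - int s)) (hd ss)
         (sum_list ss)"
    using d by simp_all
qed

section \<open>The \<open>q\<close>-exponential series and its inverse\<close>

lemma q_falling_of_nat:
  "q_falling q p (real n) k = (\<Prod>i<k. q_num q ((int n - int i) * p))"
proof -
  have "(real n - real i) * of_int p = of_int ((int n - int i) * p)" for i
    by simp
  then show ?thesis unfolding q_falling_def by (simp only: floor_of_int)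
qed

text \<open>Multiplying by \<open>p\<close> cancels the division, so the floor is exact. The right
  side is the product that U^k produces on a monomial, up to the power of \<open>h\<close>.\<close>

lemma q_falling_of_nat_shift:
  assumes "p \<noteq> 0"
  shows "q_falling q p (real j - real a + real b / of_int p) k =
           (\<Prod>i<k. q_num q (int j * p - int a * p + int b - int i * p))"
proof -
  have "(real j - real a + real b / of_int p - real i) * of_int p =
        of_int (int j * p - int a * p + int b - int i * p)" for i
    using assms by (simp add: field_simps)
  then show ?thesis unfolding q_falling_def by (simp only: floor_of_int)
qed

lemma q_falling_Suc_Suc:
  "q_falling q p (real (Suc n)) (Suc k) = q_num q (int (Suc n) * p) * q_falling q p (real n) k"
  unfolding q_falling_of_nat by (subst prod.lessThan_Suc_shift) simp

lemma q_factorial_0: "q_factorial q p 0 = 1"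
  by (simp add: q_factorial_def q_falling_def)

lemma q_factorial_Suc: "q_factorial q p (Suc n) = q_num q (int (Suc n) * p) * q_factorial q p n"
  unfolding q_factorial_def by (rule q_falling_Suc_Suc)

text \<open>Turns a falling factorial over [n]! into 1/[n-k]!, the form needed in a Cauchy
  product.\<close>

lemma q_factorial_eq_q_falling_mult:
  "k \<le> n \<Longrightarrow> q_factorial q p n = q_falling q p (real n) k * q_factorial q p (n - k)"
proof (induction k arbitrary: n)
  case 0
  then show ?case by (simp add: q_falling_def)
next
  case (Suc k)
  then obtain m where m: "n = Suc m" "k \<le> m" by (cases n) auto
  have "q_factorial q p n = q_num q (int (Suc m) * p) * q_factorial q p m"
    by (simp only: m(1) q_factorial_Suc)
  also have "\<dots> = q_num q (int (Suc m) * p) * q_falling q p (real m) k * q_factorial q p (m - k)"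
    by (simp only: Suc.IH[OF m(2)] mult.assoc)
  finally show ?case by (simp only: m(1) q_falling_Suc_Suc diff_Suc_Suc)
qed

lemma q_falling_eq_0: "n < k \<Longrightarrow> q_falling q p (real n) k = 0"
  unfolding q_falling_of_nat by (intro prod_zero bexI[of _ n]) auto

lemma q_factorial_neq_0:
  assumes "q \<noteq> 0" "q = 1 \<or> (\<forall>m::nat. m > 0 \<longrightarrow> q ^ m \<noteq> 1)" "p \<noteq> 0"
  shows "q_factorial q p n \<noteq> 0"
proof (induction n)
  case (Suc n)
  have "q_num q (int (Suc n) * p) \<noteq> 0"
    using assms(3) by (intro q_num_neq_0[OF assms(1,2)]) auto
  then show ?case using Suc by (simp add: q_factorial_Suc)
qed (simp add: q_factorial_0)

text \<open>
  Multiplied by \<open>[np]\<close>, the sum telescopes because \<open>[np] = [jp] + q\<^sup>j\<^sup>p[(n-j)p]\<close>.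
\<close>

lemma sum_q_exponential_inverse:
  assumes "q \<noteq> 0" "q = 1 \<or> (\<forall>m::nat. m > 0 \<longrightarrow> q ^ m \<noteq> 1)" "p \<noteq> 0" "n > 0"
  shows "(\<Sum>j\<le>n. (-1) ^ j * q powi (int (j choose 2) * p)
            / (q_factorial q p j * q_factorial q p (n - j))) = 0"
proof -
  define a where "a j = (-1) ^ j * q powi (int (j choose 2) * p)
    / (q_factorial q p j * q_factorial q p (n - j))" for j
  \<comment> \<open>Both ends of the telescope vanish: \<open>T 0\<close> by [0] = 0, and
    \<open>T (Suc n)\<close> by the cut-off.\<close>
  define T where "T j = (if j \<le> n then q_num q (int j * p) * a j else 0)" for j
  note nz = q_factorial_neq_0[OF assms(1-3)]
  have "q_num q (int n * p) * a j = T j - T (Suc j)" if jn: "j \<le> n" for j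
  proof -
    have "q_num q (int n * p) =
        q_num q (int j * p) + q powi (int j * p) * q_num q (int (n - j) * p)"
      using q_num_add[OF assms(1), of "int j * p" "int (n - j) * p"] jn
      by (simp add: of_nat_diff algebra_simps)
    moreover have "q powi (int j * p) * q_num q (int (n - j) * p) * a j = - T (Suc j)"
    proof (cases "j = n")
      case False
      then obtain m where m: "n = Suc (j + m)"
        using jn less_imp_Suc_add[of j n] by auto
      \<comment> \<open>The binomial coefficient grows by exactly \<open>j\<close>, which matches
        the factor q^(jp) in the addition rule.\<close>
      have pow: "q powi (int (Suc j choose 2) * p) =
          q powi (int j * p) * q powi (int (j choose 2) * p)"
        using assms(1)
        by (simp add: numeral_2_eq_2 distrib_right power_int_add)
      have "q_num q (int (Suc i) * p) \<noteq> 0" for i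
        using assms(3) by (intro q_num_neq_0[OF assms(1,2)]) auto
      moreover have "n - j = Suc m" "n - Suc j = m" "Suc j \<le> n" using m by auto
      ultimately show ?thesis
        unfolding T_def a_def using nz[of j] nz[of m]
        by (simp add: pow q_factorial_Suc divide_simps del: of_nat_Suc binomial_Suc_Suc)
    qed (simp add: T_def)
    ultimately show ?thesis using jn by (simp add: T_def distrib_right)
  qed
  then have "q_num q (int n * p) * (\<Sum>j\<le>n. a j) = (\<Sum>j<Suc n. T j - T (Suc j))"
    by (simp add: sum_distrib_left lessThan_Suc_atMost)
  also have "\<dots> = 0"
    by (subst sum_lessThan_telescope') (simp add: T_def)
  finally show ?thesis
    using q_num_neq_0[OF assms(1,2), of "int n * p"] assms(3,4) by (simp add: a_def)
qed

section \<open>Comparing the two sides on monomials\<close>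

lemma Omega_snoc:
  assumes "length rs = length ss"
  shows "Omega s q (rs @ [r]) (ss @ [t]) j = Omega s q rs ss j *
     q_falling q (1 - int s) (real j - real (sum_list ss)
       + real (sum_list rs) / of_int (1 - int s)) t"
  using assms by (simp add: Omega_def nth_append)

text \<open>With p = 1 - s, the blocks already applied move the exponent to p (N - |s| + |r|/p),
  with sums over those blocks. This is \<open>p\<close> times the argument of the next factor of
  \<Omega>, so the next U power yields that factor.\<close>

lemma act_H_word_delta:
  assumes "s \<noteq> 1" "length rs = length ss"
  shows "act s h q (H_word rs ss) (delta (int N * (1 - int s))) =
    (\<lambda>n. h ^ sum_list ss * Omega s q rs ss N *
      delta (int N * (1 - int s) - int (sum_list ss) * (1 - int s) + int (sum_list rs)) n)"
  using assms(2)
proof (induction ss arbitrary: rs rule: rev_induct)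
  case Nil
  then show ?case by (simp add: H_word_def act_one Omega_def)
next
  case (snoc t ss)
  then obtain rs' r where rs: "rs = rs' @ [r]" "length rs' = length ss"
    by (cases rs rule: rev_cases) auto
  let ?m = "int N * (1 - int s) - int (sum_list ss) * (1 - int s) + int (sum_list rs')"
  have deg: "int N * (1 - int s) - int (sum_list (ss @ [t])) * (1 - int s) + int (sum_list (rs' @ [r]))
      = ?m - int t * (1 - int s) + int r"
    by (simp add: algebra_simps)
  have "q_falling q (1 - int s) (real N - real (sum_list ss)
       + real (sum_list rs') / of_int (1 - int s)) t = (\<Prod>i<t. q_num q (?m - int i * (1 - int s)))"
    using assms(1) by (intro q_falling_of_nat_shift) simp
  then show ?case
    unfolding rs(1) H_word_snoc[OF rs(2)] Omega_snoc[OF rs(2)] deg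
    by (simp only: act_mult snoc.IH[OF rs(2)] act_scale act_gen_U_power_delta act_gen_V_power_delta)
       (simp add: power_add mult_ac)
qed

text \<open>The word and its normal form act identically on x^(Np), p = 1 - s. By homogeneity every
  term lands on the same monomial, whose coefficient is compared.\<close>

lemma Omega_eq_sum_S_coeff:
  assumes "s \<noteq> 1" "h \<noteq> 0" "q \<noteq> 0" "q = 1 \<or> (\<forall>m::nat. m > 0 \<longrightarrow> q ^ m \<noteq> 1)"
    and "length rs = length ss" "ss \<noteq> []"
  shows "h ^ sum_list ss * Omega s q rs ss N =
     (\<Sum>k\<in>{hd ss..sum_list ss}. S_coeff s h q rs ss k * (h ^ k * q_falling q (1 - int s) (real N) k))"
proof -
  define c where "c = normal_coeffs s h q (H_word rs ss)"
  let ?E = "int (sum_list rs) - int (sum_list ss) * (1 - int s)"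
  let ?G = "\<lambda>k. h ^ k * q_falling q (1 - int s) (real N) k"
  let ?S = "S_coeff s h q rs ss"
  note c = normal_coeffs_H_word[OF assms, folded c_def]
  have keys: "int i = ?E + int k * (1 - int s)" "hd ss \<le> k" "k \<le> sum_list ss"
    if "(i, k) \<in> Poly_Mapping.keys c" for i k
    using that c(2) by (auto simp: homogeneous_exponents_def)
  have S: "?S k = (if ?E + int k * (1 - int s) < 0 then 0
      else Poly_Mapping.lookup c (nat (?E + int k * (1 - int s)), k))" for k
    by (simp add: S_coeff_def c_def Let_def algebra_simps)
  have "h ^ sum_list ss * Omega s q rs ss N =
      act s h q (normal_sum c) (delta (int N * (1 - int s))) (int N * (1 - int s) + ?E)"
    using fun_cong[OF act_H_word_delta[OF assms(1,5), of h q N], of "int N * (1 - int s) + ?E"]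
    unfolding act_quot_eq[OF assms(3) c(1)] by (simp add: delta_def)
  also have "\<dots> = (\<Sum>x\<in>Poly_Mapping.keys c. ?S (snd x) * ?G (snd x))"
    unfolding act_normal_sum_delta
  proof (intro sum.cong refl, clarify)
    fix i k assume ik: "(i, k) \<in> Poly_Mapping.keys c"
    have "?S k = Poly_Mapping.lookup c (i, k)"
      using keys(1)[OF ik] unfolding S by (simp flip: keys(1)[OF ik])
    moreover have "delta (int N * (1 - int s) - int k * (1 - int s) + int i)
        (int N * (1 - int s) + ?E) = 1"
      using keys(1)[OF ik] by (simp add: delta_def)
    ultimately show "Poly_Mapping.lookup c (i, k) * (h ^ k
        * (\<Prod>t<k. q_num q (int N * (1 - int s) - int t * (1 - int s)))
        * delta (int N * (1 - int s) - int k * (1 - int s) + int i) (int N * (1 - int s) + ?E))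
        = ?S (snd (i, k)) * ?G (snd (i, k))"
      by (simp add: q_falling_of_nat left_diff_distrib)
  qed
  \<comment> \<open>Homogeneity determines \<open>i\<close> from \<open>k\<close>, so the sum over
    pairs is a sum over \<open>k\<close>.\<close>
  also have "\<dots> = (\<Sum>k\<in>snd ` Poly_Mapping.keys c. ?S k * ?G k)"
  proof (subst sum.reindex)
    show "inj_on snd (Poly_Mapping.keys c)"
    proof (rule inj_onI, clarify)
      fix i k i' k'
      assume "(i, k) \<in> Poly_Mapping.keys c" "(i', k') \<in> Poly_Mapping.keys c"
        and "snd (i, k) = snd (i', k')"
      then show "i = i' \<and> k = k'" using keys(1)[of i k] keys(1)[of i' k'] by simp
    qed
  qed simp
  \<comment> \<open>For a \<open>k\<close> outside the support, \<open>S_coeff\<close> is zero: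
    either the V exponent is negative or the coordinate is absent.\<close>
  also have "\<dots> = (\<Sum>k\<in>{hd ss..sum_list ss}. ?S k * ?G k)"
  proof (rule sum.mono_neutral_left)
    show "\<forall>k\<in>{hd ss..sum_list ss} - snd ` Poly_Mapping.keys c. ?S k * ?G k = 0"
    proof
      fix k assume "k \<in> {hd ss..sum_list ss} - snd ` Poly_Mapping.keys c"
      then have "(i, k) \<notin> Poly_Mapping.keys c" for i by force
      then show "?S k * ?G k = 0" by (simp add: S in_keys_iff)
    qed
  qed (use keys in auto)
  finally show ?thesis .
qed

theorem corollary14:
  fixes s n :: nat and h q :: complex and rs ss :: "nat list"
  assumes "s \<noteq> 1"
    and "h \<noteq> 0"
    and "q \<noteq> 0"
    and "q = 1 \<or> (\<forall>m::nat. m > 0 \<longrightarrow> q ^ m \<noteq> 1)"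
    and "n \<ge> 1"
    and "length rs = n"
    and "length ss = n"
  shows "fps_of_poly (bell_poly s h q rs ss) =
      Abs_fps (\<lambda>j. h powi (int (sum_list ss) - int j) * (-1) ^ j
                   * q powi (int (j choose 2) * (1 - int s)) / q_factorial q (1 - int s) j)
    * Abs_fps (\<lambda>j. Omega s q rs ss j / (h ^ j * q_factorial q (1 - int s) j))"
    (is "?B = ?F * ?G")
proof -
  let ?p = "1 - int s"
  let ?S = "S_coeff s h q rs ss"
  have p: "?p \<noteq> 0" using assms(1) by simp
  note nz = q_factorial_neq_0[OF assms(3,4) p]
  \<comment> \<open>The q-exponential of x/h, scaled by h^(-|s|) so that it is exactly inverse to
    the first factor.\<close>
  define E where "E = Abs_fps (\<lambda>j. 1 / (h ^ sum_list ss * h ^ j * q_factorial q ?p j))"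
  have B_nth: "fps_nth ?B k = (if k \<in> {hd ss..sum_list ss} then ?S k else 0)" for k
    by (simp add: bell_poly_def coeff_sum)
  have "?F * E = 1"
  proof (rule fps_ext)
    fix m
    have "fps_nth (?F * E) m = (\<Sum>j\<le>m. ((-1) ^ j * q powi (int (j choose 2) * ?p)
            / (q_factorial q ?p j * q_factorial q ?p (m - j))) / h ^ m)"
      unfolding fps_mult_nth atLeast0AtMost E_def
    proof (intro sum.cong refl)
      fix j assume "j \<in> {..m}"
      \<comment> \<open>The powers of \<open>h\<close> in each summand combine to h^(-m),
        independent of \<open>j\<close>, and can be pulled out of the sum.\<close>
      then have "h ^ m = h ^ j * h ^ (m - j)" by (simp flip: power_add)
      then show "fps_nth ?F j * fps_nth (Abs_fps (\<lambda>j. 1 / (h ^ sum_list ss * h ^ j * q_factorial q ?p j))) (m - j)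
        = ((-1) ^ j * q powi (int (j choose 2) * ?p)
            / (q_factorial q ?p j * q_factorial q ?p (m - j))) / h ^ m"
        using assms(2) nz by (simp add: power_int_diff)
    qed
    also have "\<dots> = (\<Sum>j\<le>m. (-1) ^ j * q powi (int (j choose 2) * ?p)
            / (q_factorial q ?p j * q_factorial q ?p (m - j))) / h ^ m"
      by (rule sum_divide_distrib[symmetric])
    also have "\<dots> = fps_nth 1 m"
    proof (cases "m = 0")
      case False
      then show ?thesis using sum_q_exponential_inverse[OF assms(3,4) p, of m] by simp
    qed (simp add: q_factorial_0 numeral_2_eq_2)
    finally show "fps_nth (?F * E) m = fps_nth 1 m" .
  qed
  moreover have "?G = ?B * E"
  proof (rule fps_ext)
    fix N
    have "h ^ sum_list ss * Omega s q rs ss N =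
        (\<Sum>k\<in>{hd ss..sum_list ss}. ?S k * (h ^ k * q_falling q ?p (real N) k))"
      using assms by (intro Omega_eq_sum_S_coeff) auto
    then have "Omega s q rs ss N = (\<Sum>k\<in>{hd ss..sum_list ss}. ?S k * (h ^ k * q_falling q ?p (real N) k))
         / h ^ sum_list ss"
      using assms(2) by (simp add: eq_divide_eq mult.commute)
    then have "fps_nth ?G N = (\<Sum>k\<in>{hd ss..sum_list ss}. ?S k * (h ^ k * q_falling q ?p (real N) k))
         / (h ^ sum_list ss * (h ^ N * q_factorial q ?p N))"
      by simp
    also have "\<dots> = (\<Sum>k\<in>{hd ss..sum_list ss}. ?S k * (h ^ k * q_falling q ?p (real N) k)
         / (h ^ sum_list ss * (h ^ N * q_factorial q ?p N)))"
      by (rule sum_divide_distrib)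
    \<comment> \<open>Terms with \<open>k > N\<close> vanish through \<open>q_falling_eq_0\<close>,
      which leaves the index range of a Cauchy product.\<close>
    also have "\<dots> = (\<Sum>k\<in>{hd ss..sum_list ss} \<inter> {..N}. ?S k * fps_nth E (N - k))"
    proof (rule sum.mono_neutral_cong_right)
      fix k assume "k \<in> {hd ss..sum_list ss} \<inter> {..N}"
      then have "h ^ N = h ^ k * h ^ (N - k)"
        "q_factorial q ?p N = q_falling q ?p (real N) k * q_factorial q ?p (N - k)"
        using q_factorial_eq_q_falling_mult[of k N q ?p] by (simp_all flip: power_add)
      then show "?S k * (h ^ k * q_falling q ?p (real N) k)
          / (h ^ sum_list ss * (h ^ N * q_factorial q ?p N)) = ?S k * fps_nth E (N - k)"
        using assms(2) nz[of N] by (simp add: E_def)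
    qed (auto simp: q_falling_eq_0)
    also have "\<dots> = fps_nth (?B * E) N"
      unfolding fps_mult_nth B_nth atLeast0AtMost
      by (rule sum.mono_neutral_cong_left) auto
    finally show "fps_nth ?G N = fps_nth (?B * E) N" .
  qed
  \<comment> \<open>Substituting the second identity gives F (B E) = B (F E) = B.\<close>
  ultimately show ?thesis
    by (simp only: mult.left_commute[of ?F ?B E]) simp
qed

end
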